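(* Let $X$ be a nonempty set and let $R$ be a ring of functions $X \to \mathbb{Z}$ (under pointwise operations) containing all constant functions. Then every first-order $\mathcal{L}^+_R$-formula $\varphi(x_1,\dots,x_d)$ is logically equivalent to an $\mathcal{L}^+_R$-formula with $R$-bounded quantifiers.
   Context: Languages: $\mathcal{L}_{Pres}=\{0,1,<,-,+\}$ (constants $0,1$, order, unary negation, binary addition); $\mathcal{L}^+_{Pres}=\mathcal{L}_{Pres}\cup\{D_n : n\in\mathbb{N}\}$ with $D_n$ a unary predicate for divisibility by $n$ ($D_0$ always false); $\mathcal{L}_R=\mathcal{L}_{Pres}\cup\{f_\alpha:\alpha\in R\}$ with $f_\alpha$ unary function symbols (written $\alpha\cdot s$), and $\mathcal{L}^+_R=\mathcal{L}_R\cup\{D_\alpha:\alpha\in R\}$ with $D_\alpha$ unary predicates. Semantics depend on a parameter $t\in X$: for an $\mathcal{L}^+_R$-formula $\varphi$, $\varphi_t$ is the $\mathcal{L}^+_{Pres}$-formula obtained by replacing each term $\alpha\cdot s$ by $s+\dots+s$ ($\alpha(t)$ copies) if $\alpha(t)>0$, by $-(s+\dots+s)$ ($|\alpha(t)|$ copies) if $\alpha(t)<0$, by $0$ if $\alpha(t)=0$, and each $D_\alpha(s)$ by $D_{\alpha(t)}(s)$ (always false if $\alpha(t)=0$); $\varphi_t$ is interpreted in $\mathbb{Z}$ in the usual way. Two $\mathcal{L}^+_R$-formulas $\varphi(x_1,\dots,x_d)$, $\psi(x_1,\dots,x_d)$ are logically equivalent if for every $t\in X$ and every $(k_1,\dots,k_d)\in\mathbb{Z}^d$,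 $\varphi_t(k_1,\dots,k_d)$ holds in $\mathbb{Z}$ iff $\psi_t(k_1,\dots,k_d)$ holds in $\mathbb{Z}$. An $R$-bounded existential quantifier applied to $\theta(\bar x,z)$ gives $\exists z\,[0\le z\le \alpha \wedge \theta(\bar x,z)]$ and an $R$-bounded universal quantifier gives $\forall z\,[0\le z\le\alpha\rightarrow\theta(\bar x,z)]$, for some $\alpha\in R$ (here $\alpha$ denotes the term $f_\alpha(1)$). An $\mathcal{L}^+_R$-formula with $R$-bounded quantifiers is a member of the smallest class of $\mathcal{L}^+_R$-formulas containing all atomic formulas and closed under Boolean combinations and $R$-bounded existential and universal quantifiers. Quantification is only over $\mathbb{Z}$-valued variables, never over $t$. *)

theory Defs
  imports Main "HOL-Library.FuncSet"
begin

text \<open>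
  Functions \<^term>\<open>X \<rightarrow> UNIV\<close> are represented extensionally, i.e. they are \<^term>\<open>undefined\<close> off \<^term>\<open>X\<close>,
  so that equality of elements of \<open>R\<close> is equality of functions on \<open>X\<close>.
\<close>

definition function_ring :: "'x set \<Rightarrow> ('x \<Rightarrow> int) set \<Rightarrow> bool" where
  "function_ring X R \<longleftrightarrow>
     R \<subseteq> X \<rightarrow>\<^sub>E UNIV \<and>
     (\<lambda>t\<in>X. 0) \<in> R \<and> (\<lambda>t\<in>X. 1) \<in> R \<and>
     (\<forall>\<alpha>\<in>R. (\<lambda>t\<in>X. - \<alpha> t) \<in> R) \<and>
     (\<forall>\<alpha>\<in>R. \<forall>\<beta>\<in>R. (\<lambda>t\<in>X. \<alpha> t + \<beta> t) \<in> R) \<and>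
     (\<forall>\<alpha>\<in>R. \<forall>\<beta>\<in>R. (\<lambda>t\<in>X. \<alpha> t * \<beta> t) \<in> R)"

datatype pterm =
    PVar nat
  | PZero
  | POne
  | PNeg pterm
  | PAdd pterm pterm

datatype 'x rterm =
    RVar nat
  | RZero
  | ROne
  | RNeg "'x rterm"
  | RAdd "'x rterm" "'x rterm"
  | RScale "'x \<Rightarrow> int" "'x rterm"

text \<open>First-order formulas over terms \<open>'a\<close>, with divisibility predicates indexed by \<open>'i\<close>.\<close>

datatype ('a, 'i) form =
    Eq 'a 'a
  | Less 'a 'a
  | Divis 'i 'a
  | Not "('a, 'i) form"
  | And "('a, 'i) form" "('a, 'i) form"
  | Or "('a, 'i) form" "('a, 'i) form"
  | Imp "('a, 'i) form" "('a, 'i) form"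
  | Exists nat "('a, 'i) form"
  | Forall nat "('a, 'i) form"

type_synonym pform = "(pterm, nat) form"
type_synonym 'x rform = "('x rterm, 'x \<Rightarrow> int) form"


primrec peval :: "(nat \<Rightarrow> int) \<Rightarrow> pterm \<Rightarrow> int" where
  "peval k (PVar i) = k i"
| "peval k PZero = 0"
| "peval k POne = 1"
| "peval k (PNeg s) = - peval k s"
| "peval k (PAdd s u) = peval k s + peval k u"

primrec psat :: "(nat \<Rightarrow> int) \<Rightarrow> pform \<Rightarrow> bool" where
  "psat k (Eq s u) \<longleftrightarrow> peval k s = peval k u"
| "psat k (Less s u) \<longleftrightarrow> peval k s < peval k u"
| "psat k (Divis n s) \<longleftrightarrow> n \<noteq> 0 \<and> int n dvd peval k s"
| "psat k (Not \<phi>) \<longleftrightarrow> \<not> psat k \<phi>"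
| "psat k (And \<phi> \<psi>) \<longleftrightarrow> psat k \<phi> \<and> psat k \<psi>"
| "psat k (Or \<phi> \<psi>) \<longleftrightarrow> psat k \<phi> \<or> psat k \<psi>"
| "psat k (Imp \<phi> \<psi>) \<longleftrightarrow> (psat k \<phi> \<longrightarrow> psat k \<psi>)"
| "psat k (Exists x \<phi>) \<longleftrightarrow> (\<exists>m. psat (k(x := m)) \<phi>)"
| "psat k (Forall x \<phi>) \<longleftrightarrow> (\<forall>m. psat (k(x := m)) \<phi>)"


primrec rterm_over :: "('x \<Rightarrow> int) set \<Rightarrow> 'x rterm \<Rightarrow> bool" where
  "rterm_over R (RVar i) \<longleftrightarrow> True"
| "rterm_over R RZero \<longleftrightarrow> True"
| "rterm_over R ROne \<longleftrightarrow> True"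
| "rterm_over R (RNeg s) \<longleftrightarrow> rterm_over R s"
| "rterm_over R (RAdd s u) \<longleftrightarrow> rterm_over R s \<and> rterm_over R u"
| "rterm_over R (RScale \<alpha> s) \<longleftrightarrow> \<alpha> \<in> R \<and> rterm_over R s"

primrec rform_over :: "('x \<Rightarrow> int) set \<Rightarrow> 'x rform \<Rightarrow> bool" where
  "rform_over R (Eq s u) \<longleftrightarrow> rterm_over R s \<and> rterm_over R u"
| "rform_over R (Less s u) \<longleftrightarrow> rterm_over R s \<and> rterm_over R u"
| "rform_over R (Divis \<alpha> s) \<longleftrightarrow> \<alpha> \<in> R \<and> rterm_over R s"
| "rform_over R (Not \<phi>) \<longleftrightarrow> rform_over R \<phi>"
| "rform_over R (And \<phi> \<psi>) \<longleftrightarrow> rform_over R \<phi> \<and> rform_over R \<psi>"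
| "rform_over R (Or \<phi> \<psi>) \<longleftrightarrow> rform_over R \<phi> \<and> rform_over R \<psi>"
| "rform_over R (Imp \<phi> \<psi>) \<longleftrightarrow> rform_over R \<phi> \<and> rform_over R \<psi>"
| "rform_over R (Exists x \<phi>) \<longleftrightarrow> rform_over R \<phi>"
| "rform_over R (Forall x \<phi>) \<longleftrightarrow> rform_over R \<phi>"

primrec rterm_vars :: "'x rterm \<Rightarrow> nat set" where
  "rterm_vars (RVar i) = {i}"
| "rterm_vars RZero = {}"
| "rterm_vars ROne = {}"
| "rterm_vars (RNeg s) = rterm_vars s"
| "rterm_vars (RAdd s u) = rterm_vars s \<union> rterm_vars u"
| "rterm_vars (RScale \<alpha> s) = rterm_vars s"

primrec free_vars :: "'x rform \<Rightarrow> nat set" where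
  "free_vars (Eq s u) = rterm_vars s \<union> rterm_vars u"
| "free_vars (Less s u) = rterm_vars s \<union> rterm_vars u"
| "free_vars (Divis \<alpha> s) = rterm_vars s"
| "free_vars (Not \<phi>) = free_vars \<phi>"
| "free_vars (And \<phi> \<psi>) = free_vars \<phi> \<union> free_vars \<psi>"
| "free_vars (Or \<phi> \<psi>) = free_vars \<phi> \<union> free_vars \<psi>"
| "free_vars (Imp \<phi> \<psi>) = free_vars \<phi> \<union> free_vars \<psi>"
| "free_vars (Exists x \<phi>) = free_vars \<phi> - {x}"
| "free_vars (Forall x \<phi>) = free_vars \<phi> - {x}"


text \<open>\<open>copies n s\<close> is \<open>s + \<dots> + s\<close> with \<open>n\<close> summands; it is only used for \<open>n > 0\<close>.\<close>

fun copies :: "nat \<Rightarrow> pterm \<Rightarrow> pterm" where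
  "copies 0 s = PZero"
| "copies (Suc 0) s = s"
| "copies (Suc (Suc n)) s = PAdd (copies (Suc n) s) s"

primrec inst_term :: "'x \<Rightarrow> 'x rterm \<Rightarrow> pterm" where
  "inst_term t (RVar i) = PVar i"
| "inst_term t RZero = PZero"
| "inst_term t ROne = POne"
| "inst_term t (RNeg s) = PNeg (inst_term t s)"
| "inst_term t (RAdd s u) = PAdd (inst_term t s) (inst_term t u)"
| "inst_term t (RScale \<alpha> s) =
     (if \<alpha> t > 0 then copies (nat (\<alpha> t)) (inst_term t s)
      else if \<alpha> t < 0 then PNeg (copies (nat \<bar>\<alpha> t\<bar>) (inst_term t s))
      else PZero)"

text \<open>
  The formula \<open>\<phi>\<^sub>t\<close>. The absolute value is there because the predicates \<open>D\<^sub>n\<close> are indexed by natural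
  numbers: for negative \<open>\<alpha>(t)\<close>, divisibility by \<open>\<alpha>(t)\<close> is divisibility by \<open>-\<alpha>(t)\<close>.
\<close>

definition inst_form :: "'x \<Rightarrow> 'x rform \<Rightarrow> pform" where
  "inst_form t = map_form (inst_term t) (\<lambda>\<alpha>. nat \<bar>\<alpha> t\<bar>)"

text \<open>
  An assignment gives a value to every variable, but only those of the free variables matter;
  for formulas in \<open>x\<^sub>1, \<dots>, x\<^sub>d\<close> this is quantification over \<open>\<int>\<^sup>d\<close>.
\<close>

definition logically_equivalent :: "'x set \<Rightarrow> 'x rform \<Rightarrow> 'x rform \<Rightarrow> bool" where
  "logically_equivalent X \<phi> \<psi> \<longleftrightarrow>
     (\<forall>t\<in>X. \<forall>k. psat k (inst_form t \<phi>) \<longleftrightarrow> psat k (inst_form t \<psi>))"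


definition Leq :: "'x rterm \<Rightarrow> 'x rterm \<Rightarrow> 'x rform" where
  "Leq s u = Or (Less s u) (Eq s u)"

definition in_range :: "('x \<Rightarrow> int) \<Rightarrow> nat \<Rightarrow> 'x rform" where
  "in_range \<alpha> z = And (Leq RZero (RVar z)) (Leq (RVar z) (RScale \<alpha> ROne))"

inductive bounded_form :: "('x \<Rightarrow> int) set \<Rightarrow> 'x rform \<Rightarrow> bool" for R where
  Eq: "rterm_over R s \<Longrightarrow> rterm_over R u \<Longrightarrow> bounded_form R (Eq s u)"
| Less: "rterm_over R s \<Longrightarrow> rterm_over R u \<Longrightarrow> bounded_form R (Less s u)"
| Divis: "\<alpha> \<in> R \<Longrightarrow> rterm_over R s \<Longrightarrow> bounded_form R (Divis \<alpha> s)"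
| Not: "bounded_form R \<phi> \<Longrightarrow> bounded_form R (Not \<phi>)"
| And: "bounded_form R \<phi> \<Longrightarrow> bounded_form R \<psi> \<Longrightarrow> bounded_form R (And \<phi> \<psi>)"
| Or: "bounded_form R \<phi> \<Longrightarrow> bounded_form R \<psi> \<Longrightarrow> bounded_form R (Or \<phi> \<psi>)"
| Imp: "bounded_form R \<phi> \<Longrightarrow> bounded_form R \<psi> \<Longrightarrow> bounded_form R (Imp \<phi> \<psi>)"
| Exists: "\<alpha> \<in> R \<Longrightarrow> bounded_form R \<theta> \<Longrightarrow> bounded_form R (Exists z (And (in_range \<alpha> z) \<theta>))"
| Forall: "\<alpha> \<in> R \<Longrightarrow> bounded_form R \<theta> \<Longrightarrow> bounded_form R (Forall z (Imp (in_range \<alpha> z) \<theta>))"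

end

theory Submission
  imports Defs
begin

text \<open>
  It suffices to eliminate \<open>\<exists>x\<close> in front of a formula \<open>\<theta>\<close> with bounded quantifiers.
  For fixed \<open>t\<close> and fixed values of the other variables, let \<open>p > 0\<close> be a common multiple of the
  nonzero moduli occurring in \<open>\<theta>\<close>. The truth value of \<open>\<theta>\<close> at \<open>x\<close> and at \<open>x \<plusminus> p\<close> can
  differ only if the value of one of the linear expressions \<open>\<beta>x + s\<close> in \<open>\<theta>\<close> is small; as the
  bound variables range over intervals bounded by elements of \<open>R\<close>, their contribution to \<open>s\<close> can be
  absorbed into the error bound, so that \<open>\<bar>\<beta>x + s\<bar> \<le> N\<close> for one of finitely many triples
  \<open>(\<beta>, s, N)\<close> with \<open>\<beta>, N \<in> R\<close>, \<open>\<beta>(t) \<noteq> 0\<close>, and \<open>s\<close> free of bound variables. A solution of least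
  absolute value is therefore either smaller than \<open>p\<close> or of this kind. Hence \<open>x = (z - N - s)/\<beta>\<close>
  with \<open>0 \<le> z \<le> 2N\<close>, and this can be substituted into \<open>\<theta>\<close> after multiplying all terms by \<open>\<beta>\<close>.
\<close>

section \<open>Evaluation of instantiated terms and formulas\<close>

abbreviation reval :: "'x \<Rightarrow> (nat \<Rightarrow> int) \<Rightarrow> 'x rterm \<Rightarrow> int" where
  "reval t k s \<equiv> peval k (inst_term t s)"

abbreviation rsat :: "'x \<Rightarrow> (nat \<Rightarrow> int) \<Rightarrow> 'x rform \<Rightarrow> bool" where
  "rsat t k \<phi> \<equiv> psat k (inst_form t \<phi>)"

lemma peval_copies [simp]: "peval k (copies n s) = int n * peval k s"
  by (induction n s rule: copies.induct) (auto simp: algebra_simps)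

text \<open>All sign cases of a scaled term collapse into multiplication by
  \<open>\<alpha> t\<close>. From here on terms are evaluated by these equations alone, so the
  unfolding of \<open>inst_term\<close> is withdrawn from the simplifier below.\<close>

lemma reval_simps [simp]:
  "reval t k (RVar i) = k i"
  "reval t k RZero = 0"
  "reval t k ROne = 1"
  "reval t k (RNeg s) = - reval t k s"
  "reval t k (RAdd s u) = reval t k s + reval t k u"
  "reval t k (RScale \<alpha> s) = \<alpha> t * reval t k s"
  by auto

declare inst_term.simps [simp del]

text \<open>Divisibility does not see signs, so the absolute value in \<open>inst_form\<close>
  disappears from the clause for \<open>Divis\<close>.\<close>

lemma rsat_simps [simp]:
  "rsat t k (Eq s u) \<longleftrightarrow> reval t k s = reval t k u"
  "rsat t k (Less s u) \<longleftrightarrow> reval t k s < reval t k u"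
  "rsat t k (Divis \<alpha> s) \<longleftrightarrow> \<alpha> t \<noteq> 0 \<and> \<alpha> t dvd reval t k s"
  "rsat t k (Not \<phi>) \<longleftrightarrow> \<not> rsat t k \<phi>"
  "rsat t k (And \<phi> \<psi>) \<longleftrightarrow> rsat t k \<phi> \<and> rsat t k \<psi>"
  "rsat t k (Or \<phi> \<psi>) \<longleftrightarrow> rsat t k \<phi> \<or> rsat t k \<psi>"
  "rsat t k (Imp \<phi> \<psi>) \<longleftrightarrow> (rsat t k \<phi> \<longrightarrow> rsat t k \<psi>)"
  "rsat t k (Exists x \<phi>) \<longleftrightarrow> (\<exists>m. rsat t (k(x := m)) \<phi>)"
  "rsat t k (Forall x \<phi>) \<longleftrightarrow> (\<forall>m. rsat t (k(x := m)) \<phi>)"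
  by (auto simp: inst_form_def)

lemma rsat_in_range [simp]: "rsat t k (in_range \<alpha> z) \<longleftrightarrow> 0 \<le> k z \<and> k z \<le> \<alpha> t"
  by (auto simp: in_range_def Leq_def)

lemma free_vars_in_range [simp]: "free_vars (in_range \<alpha> z) = {z}"
  by (auto simp: in_range_def Leq_def)

lemma reval_cong: "(\<And>i. i \<in> rterm_vars s \<Longrightarrow> k i = k' i) \<Longrightarrow> reval t k s = reval t k' s"
  by (induction s) auto

lemma reval_upd_fresh [simp]: "z \<notin> rterm_vars s \<Longrightarrow> reval t (k(z := v)) s = reval t k s"
  by (rule reval_cong) auto

lemma finite_rterm_vars [simp]: "finite (rterm_vars s)"
  by (induction s) auto

lemma finite_free_vars [simp]: "finite (free_vars \<phi>)"
  by (induction \<phi>) auto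

lemma finite_moduli: "finite (set2_form \<phi>)"
  by (induction \<phi>) auto

lemma moduli_in_range [simp]: "set2_form (in_range \<alpha> z) = {}"
  by (auto simp: in_range_def Leq_def)

lemma moduli_subset: "bounded_form R \<theta> \<Longrightarrow> set2_form \<theta> \<subseteq> R"
  by (induction rule: bounded_form.induct) auto

lemma fresh_var: "finite (A :: nat set) \<Longrightarrow> \<exists>z. z \<notin> A"
  by (rule ex_new_if_finite[OF infinite_UNIV_nat])

text \<open>\<open>R\<close> need not be closed under absolute values, so the error bounds use
  squares instead; a nonzero integer has absolute value at least 1.\<close>

lemma abs_le_square: "\<bar>a :: int\<bar> \<le> a * a"
proof (cases "a = 0")
  case False
  then have "\<bar>a\<bar> * 1 \<le> \<bar>a\<bar> * \<bar>a\<bar>"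
    by (intro mult_left_mono) auto
  then show ?thesis by simp
qed simp

section \<open>Closure of \<open>R\<close> and linearity of terms\<close>

context
  fixes X :: "'x set" and R :: "('x \<Rightarrow> int) set"
  assumes ring: "function_ring X R"
begin

lemma ring_closed [simp, intro]:
  "(\<lambda>t\<in>X. 0) \<in> R" "(\<lambda>t\<in>X. 1) \<in> R"
  "\<alpha> \<in> R \<Longrightarrow> (\<lambda>t\<in>X. - \<alpha> t) \<in> R"
  "\<alpha> \<in> R \<Longrightarrow> \<beta> \<in> R \<Longrightarrow> (\<lambda>t\<in>X. \<alpha> t + \<beta> t) \<in> R"
  "\<alpha> \<in> R \<Longrightarrow> \<beta> \<in> R \<Longrightarrow> (\<lambda>t\<in>X. \<alpha> t * \<beta> t) \<in> R"
  using ring by (auto simp: function_ring_def)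

text \<open>Source of all error bounds below: the square dominates |\<alpha>\<beta>| pointwise and,
  unlike |\<alpha>\<beta>|, is sure to lie in \<open>R\<close>.\<close>

lemma ring_square_plus:
  assumes "\<alpha> \<in> R" "\<beta> \<in> R" "\<gamma> \<in> R"
  obtains \<delta> where "\<delta> \<in> R" "\<And>t. t \<in> X \<Longrightarrow> \<delta> t = \<gamma> t + (\<alpha> t * \<beta> t) * (\<alpha> t * \<beta> t)"
proof
  let ?a = "\<lambda>t\<in>X. \<alpha> t * \<beta> t"
  let ?b = "\<lambda>t\<in>X. ?a t * ?a t"
  show "(\<lambda>t\<in>X. \<gamma> t + ?b t) \<in> R"
    using assms by (intro ring_closed)
qed simp

text \<open>Terms are linear in each variable: as \<open>R\<close> is closed under the ring
  operations, the coefficient of \<open>y\<close> can be collected along the structure of the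
  term.\<close>

lemma term_split:
  assumes "rterm_over R s"
  shows "\<exists>\<sigma>\<in>R. \<exists>s'. rterm_over R s' \<and> rterm_vars s' \<subseteq> rterm_vars s - {y} \<and>
           (\<forall>t\<in>X. \<forall>k. reval t k s = \<sigma> t * k y + reval t k s')"
  using assms
proof (induction s)
  case (RVar i)
  show ?case
  proof (cases "i = y")
    case True
    then show ?thesis
      by (intro bexI[of _ "\<lambda>t\<in>X. 1"] exI[of _ RZero]) auto
  next
    case False
    then show ?thesis
      by (intro bexI[of _ "\<lambda>t\<in>X. 0"] exI[of _ "RVar i"]) auto
  qed
next
  case RZero
  show ?case by (intro bexI[of _ "\<lambda>t\<in>X. 0"] exI[of _ RZero]) auto
next
  case ROne
  show ?case by (intro bexI[of _ "\<lambda>t\<in>X. 0"] exI[of _ ROne]) auto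
next
  case (RNeg s)
  then obtain \<sigma> s' where "\<sigma> \<in> R" "rterm_over R s'" "rterm_vars s' \<subseteq> rterm_vars s - {y}"
    "\<forall>t\<in>X. \<forall>k. reval t k s = \<sigma> t * k y + reval t k s'" by auto
  then show ?case
    by (intro bexI[of _ "\<lambda>t\<in>X. - \<sigma> t"] exI[of _ "RNeg s'"]) auto
next
  case (RAdd s u)
  then obtain \<sigma> s' \<tau> u' where "\<sigma> \<in> R" "rterm_over R s'" "rterm_vars s' \<subseteq> rterm_vars s - {y}"
    "\<forall>t\<in>X. \<forall>k. reval t k s = \<sigma> t * k y + reval t k s'"
    "\<tau> \<in> R" "rterm_over R u'" "rterm_vars u' \<subseteq> rterm_vars u - {y}"
    "\<forall>t\<in>X. \<forall>k. reval t k u = \<tau> t * k y + reval t k u'" by auto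
  then show ?case
    by (intro bexI[of _ "\<lambda>t\<in>X. \<sigma> t + \<tau> t"] exI[of _ "RAdd s' u'"]) (auto simp: algebra_simps)
next
  case (RScale \<alpha> s)
  then obtain \<sigma> s' where "\<sigma> \<in> R" "rterm_over R s'" "rterm_vars s' \<subseteq> rterm_vars s - {y}"
    "\<forall>t\<in>X. \<forall>k. reval t k s = \<sigma> t * k y + reval t k s'" by auto
  with RScale show ?case
    by (intro bexI[of _ "\<lambda>t\<in>X. \<alpha> t * \<sigma> t"] exI[of _ "RScale \<alpha> s'"]) (auto simp: algebra_simps)
qed

section \<open>Changes of truth value under shifts of one variable\<close>

text \<open>A triple \<open>(\<beta>, s, N)\<close> encodes the condition |\<beta>x + s| \<le> N on
  the variable x to be eliminated. The set \<open>V\<close> will consist of the free variables other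
  than x, so that \<open>s\<close> contains neither x nor bound variables.\<close>

definition admissible :: "nat set \<Rightarrow> (('x \<Rightarrow> int) \<times> 'x rterm \<times> ('x \<Rightarrow> int)) set \<Rightarrow> bool" where
  "admissible V L \<longleftrightarrow> finite L \<and>
     (\<forall>(\<beta>, s, N)\<in>L. \<beta> \<in> R \<and> N \<in> R \<and> rterm_over R s \<and> rterm_vars s \<subseteq> V)"

text \<open>Demanding \<open>\<beta> t \<noteq> 0\<close> makes it possible later to recover
  \<open>m\<close> from the value of the linear expression by division.\<close>

definition near ::
  "(('x \<Rightarrow> int) \<times> 'x rterm \<times> ('x \<Rightarrow> int)) set \<Rightarrow> 'x \<Rightarrow> (nat \<Rightarrow> int) \<Rightarrow> int \<Rightarrow> bool" where
  "near L t k m \<longleftrightarrow> (\<exists>(\<beta>, s, N)\<in>L. \<beta> t \<noteq> 0 \<and> \<bar>\<beta> t * m + reval t k s\<bar> \<le> N t)"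

lemma admissible_empty [simp]: "admissible V {}"
  by (simp add: admissible_def)

lemma admissible_Un: "admissible V L \<Longrightarrow> admissible W L' \<Longrightarrow> admissible (V \<union> W) (L \<union> L')"
  unfolding admissible_def by fast

lemma near_Un: "near (L \<union> L') t k m \<longleftrightarrow> near L t k m \<or> near L' t k m"
  by (auto simp: near_def)

text \<open>The shift \<open>p\<close> is an arbitrary integer of either sign because a common
  multiple of the moduli depends on t and need not come from an element of \<open>R\<close>; only
  its bound \<open>M\<close> does.\<close>

definition controls ::
  "nat \<Rightarrow> ('x \<Rightarrow> int) \<Rightarrow> 'x rform \<Rightarrow> (('x \<Rightarrow> int) \<times> 'x rterm \<times> ('x \<Rightarrow> int)) set \<Rightarrow> bool" where
  "controls x M \<theta> L \<longleftrightarrow> (\<forall>t\<in>X. \<forall>k m p. \<bar>p\<bar> \<le> M t \<longrightarrow>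
     (\<forall>\<gamma>\<in>set2_form \<theta>. \<gamma> t \<noteq> 0 \<longrightarrow> \<gamma> t dvd p) \<longrightarrow>
     rsat t (k(x := m)) \<theta> \<noteq> rsat t (k(x := m + p)) \<theta> \<longrightarrow> near L t k m)"

text \<open>The comparison asks whether a single expression \<beta>x + c is zero, or negative. A
  shift of x by p adds \<beta>p, and this can alter the answer only if |\<beta>p| is at least the
  absolute value of the expression.\<close>

lemma controls_atom:
  assumes "rterm_over R s" "rterm_over R u" "M \<in> R"
    and \<theta>: "\<theta> = Eq s u \<or> \<theta> = Less s u"
  shows "\<exists>L. admissible (free_vars \<theta> - {x}) L \<and> controls x M \<theta> L"
proof -
  obtain \<sigma> s' where s: "\<sigma> \<in> R" "rterm_over R s'" "rterm_vars s' \<subseteq> rterm_vars s - {x}"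
    "\<And>t k. t \<in> X \<Longrightarrow> reval t k s = \<sigma> t * k x + reval t k s'"
    using term_split[OF assms(1), of x] by auto
  obtain \<tau> u' where u: "\<tau> \<in> R" "rterm_over R u'" "rterm_vars u' \<subseteq> rterm_vars u - {x}"
    "\<And>t k. t \<in> X \<Longrightarrow> reval t k u = \<tau> t * k x + reval t k u'"
    using term_split[OF assms(2), of x] by auto
  define \<beta> where "\<beta> = (\<lambda>t\<in>X. \<sigma> t + (\<lambda>t\<in>X. - \<tau> t) t)"
  have "\<beta> \<in> R"
    unfolding \<beta>_def using s(1) u(1) by (intro ring_closed)
  moreover have "\<And>t. t \<in> X \<Longrightarrow> \<beta> t = \<sigma> t - \<tau> t"
    by (simp add: \<beta>_def)
  ultimately have \<beta>: "\<beta> \<in> R" "\<And>t. t \<in> X \<Longrightarrow> \<beta> t = \<sigma> t - \<tau> t" .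
  \<comment> \<open>The square of \<beta>M lies in \<open>R\<close> and dominates |\<beta>p|
    whenever |p| \<le> M.\<close>
  obtain N where N: "N \<in> R" "\<And>t. t \<in> X \<Longrightarrow> N t = (\<beta> t * M t) * (\<beta> t * M t)"
    using ring_square_plus[OF \<beta>(1) assms(3) ring_closed(1)] by auto
  let ?L = "{(\<beta>, RAdd s' (RNeg u'), N)}"
  have "admissible (free_vars \<theta> - {x}) ?L"
    using s u \<beta> N \<theta> by (auto simp: admissible_def)
  moreover have "controls x M \<theta> ?L"
    unfolding controls_def
  proof (intro ballI allI impI)
    fix t k m p
    assume t: "t \<in> X" and p: "\<bar>p\<bar> \<le> M t"
      and differ: "rsat t (k(x := m)) \<theta> \<noteq> rsat t (k(x := m + p)) \<theta>"
    define c where "c = reval t k s' - reval t k u'"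
    have x: "x \<notin> rterm_vars s'" "x \<notin> rterm_vars u'" using s(3) u(3) by auto
    have "reval t (k(x := v)) s - reval t (k(x := v)) u = \<beta> t * v + c" for v
      using x by (simp add: s(4)[OF t] u(4)[OF t] \<beta>(2)[OF t] c_def algebra_simps)
    then have rewr: "(reval t (k(x := v)) s = reval t (k(x := v)) u) = (\<beta> t * v + c = 0)"
      "(reval t (k(x := v)) s < reval t (k(x := v)) u) = (\<beta> t * v + c < 0)" for v
      by (metis eq_iff_diff_eq_0, metis diff_less_0_iff_less)
    \<comment> \<open>Equal truth values would follow from a zero shift; its being nonzero yields
      the condition \<open>\<beta> t \<noteq> 0\<close> in \<open>near\<close>.\<close>
    have bound: "\<bar>\<beta> t * m + c\<bar> \<le> \<bar>\<beta> t * p\<bar>" and "\<beta> t * p \<noteq> 0"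
      using \<theta> differ by (auto simp: rewr distrib_left abs_if)
    note bound
    also have "\<bar>\<beta> t * p\<bar> \<le> \<bar>\<beta> t * M t\<bar>"
      using p by (auto simp: abs_mult intro!: mult_left_mono)
    also have "\<dots> \<le> N t"
      by (simp add: N(2)[OF t] abs_le_square)
    finally show "near ?L t k m"
      using \<open>\<beta> t * p \<noteq> 0\<close> by (auto simp: near_def c_def algebra_simps)
  qed
  ultimately show ?thesis by blast
qed

text \<open>A compound can change only if a constituent does, so the union of the two sets of
  triples works.\<close>

lemma controls_binary:
  assumes "\<exists>L. admissible (free_vars \<phi> - {x}) L \<and> controls x M \<phi> L"
    and "\<exists>L. admissible (free_vars \<psi> - {x}) L \<and> controls x M \<psi> L"
    and \<theta>: "\<theta> = And \<phi> \<psi> \<or> \<theta> = Or \<phi> \<psi> \<or> \<theta> = Imp \<phi> \<psi>"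
  shows "\<exists>L. admissible (free_vars \<theta> - {x}) L \<and> controls x M \<theta> L"
proof -
  obtain L L' where L: "admissible (free_vars \<phi> - {x}) L" "controls x M \<phi> L"
    and L': "admissible (free_vars \<psi> - {x}) L'" "controls x M \<psi> L'"
    using assms(1,2) by blast
  have "free_vars \<theta> - {x} = (free_vars \<phi> - {x}) \<union> (free_vars \<psi> - {x})"
    using \<theta> by auto
  then have "admissible (free_vars \<theta> - {x}) (L \<union> L')"
    using admissible_Un[OF L(1) L'(1)] by simp
  moreover have "controls x M \<theta> (L \<union> L')"
    unfolding controls_def
  proof (intro ballI allI impI)
    fix t k m p
    assume t: "t \<in> X" and p: "\<bar>p\<bar> \<le> M t"
      and dvd: "\<forall>\<gamma>\<in>set2_form \<theta>. \<gamma> t \<noteq> 0 \<longrightarrow> \<gamma> t dvd p"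
      and differ: "rsat t (k(x := m)) \<theta> \<noteq> rsat t (k(x := m + p)) \<theta>"
    have "rsat t (k(x := m)) \<phi> \<noteq> rsat t (k(x := m + p)) \<phi> \<or>
          rsat t (k(x := m)) \<psi> \<noteq> rsat t (k(x := m + p)) \<psi>"
      using \<theta> differ by auto
    moreover have "\<forall>\<gamma>\<in>set2_form \<phi>. \<gamma> t \<noteq> 0 \<longrightarrow> \<gamma> t dvd p"
      "\<forall>\<gamma>\<in>set2_form \<psi>. \<gamma> t \<noteq> 0 \<longrightarrow> \<gamma> t dvd p"
      using \<theta> dvd by auto
    ultimately show "near (L \<union> L') t k m"
      using L(2) L'(2) t p unfolding controls_def near_Un by blast
  qed
  ultimately show ?thesis by blast
qed

lemma absorb_bounded_var:
  assumes "admissible V L" "\<alpha> \<in> R"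
  shows "\<exists>L'. admissible (V - {z}) L' \<and>
    (\<forall>t\<in>X. \<forall>k m v. 0 \<le> v \<longrightarrow> v \<le> \<alpha> t \<longrightarrow> near L t (k(z := v)) m \<longrightarrow> near L' t k m)"
proof -
  have "finite L" using assms(1) by (simp add: admissible_def)
  then show ?thesis using assms(1)
  proof (induction L rule: finite_induct)
    case empty
    show ?case by (intro exI[of _ "{}"]) (auto simp: near_def)
  next
    case (insert q L)
    obtain \<beta> s N where q: "q = (\<beta>, s, N)" by (cases q)
    have adm: "admissible V L" and \<beta>: "\<beta> \<in> R" and N: "N \<in> R"
      and s: "rterm_over R s" "rterm_vars s \<subseteq> V"
      using insert.prems by (auto simp: admissible_def q)
    obtain L' where L': "admissible (V - {z}) L'"
      "\<And>t k m v. t \<in> X \<Longrightarrow> 0 \<le> v \<Longrightarrow> v \<le> \<alpha> t \<Longrightarrow> near L t (k(z := v)) m \<Longrightarrow> near L' t k m"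
      using insert.IH[OF adm] by blast
    obtain \<sigma> s' where s': "\<sigma> \<in> R" "rterm_over R s'" "rterm_vars s' \<subseteq> rterm_vars s - {z}"
      "\<And>t k. t \<in> X \<Longrightarrow> reval t k s = \<sigma> t * k z + reval t k s'"
      using term_split[OF s(1), of z] by auto
    obtain N' where N': "N' \<in> R"
      "\<And>t. t \<in> X \<Longrightarrow> N' t = N t + (\<sigma> t * \<alpha> t) * (\<sigma> t * \<alpha> t)"
      using ring_square_plus[OF s'(1) assms(2) N] by blast
    have "admissible (V - {z}) (insert (\<beta>, s', N') L')"
      using L'(1) \<beta> N' s s' by (auto simp: admissible_def)
    moreover have "near (insert (\<beta>, s', N') L') t k m"
      if t: "t \<in> X" and v: "0 \<le> v" "v \<le> \<alpha> t" and near: "near (insert q L) t (k(z := v)) m" for t k m v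
    proof (cases "near L t (k(z := v)) m")
      case True
      then show ?thesis using L'(2)[OF t v] by (auto simp: near_def)
    next
      case False
      have "z \<notin> rterm_vars s'" using s'(3) by auto
      with False near have b: "\<beta> t \<noteq> 0" "\<bar>\<beta> t * m + (\<sigma> t * v + reval t k s')\<bar> \<le> N t"
        by (auto simp: near_def q s'(4)[OF t])
      have "\<bar>\<sigma> t * v\<bar> \<le> \<bar>\<sigma> t * \<alpha> t\<bar>"
        using v by (auto simp: abs_mult intro!: mult_left_mono)
      also have "\<dots> \<le> (\<sigma> t * \<alpha> t) * (\<sigma> t * \<alpha> t)"
        by (rule abs_le_square)
      finally have "\<bar>\<beta> t * m + reval t k s'\<bar> \<le> N' t"
        using b(2) N'(2)[OF t] by linarith
      then show ?thesis using b(1) by (auto simp: near_def)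
    qed
    ultimately show ?case by blast
  qed
qed

text \<open>A change of the quantified formula is witnessed by a change of \<open>\<phi>\<close> at
  some value of \<open>z\<close> within the range, and the range allows \<open>z\<close> to be
  absorbed into the error bounds.\<close>

lemma controls_quantifier:
  assumes "\<exists>L. admissible (free_vars \<phi> - {x}) L \<and> controls x M \<phi> L" and "\<alpha> \<in> R"
    and \<theta>: "\<theta> = Exists z (And (in_range \<alpha> z) \<phi>) \<or> \<theta> = Forall z (Imp (in_range \<alpha> z) \<phi>)"
  shows "\<exists>L. admissible (free_vars \<theta> - {x}) L \<and> controls x M \<theta> L"
proof (cases "z = x")
  case True
  \<comment> \<open>The quantifier rebinds \<open>x\<close>, so the truth value does not depend on
    \<open>m\<close>.\<close>
  then have "controls x M \<theta> {}"
    using \<theta> by (auto simp: controls_def)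
  then show ?thesis by (intro exI[of _ "{}"]) simp
next
  case False
  obtain L where L: "admissible (free_vars \<phi> - {x}) L" "controls x M \<phi> L"
    using assms(1) by blast
  obtain L' where L': "admissible (free_vars \<phi> - {x} - {z}) L'"
    "\<And>t k m v. t \<in> X \<Longrightarrow> 0 \<le> v \<Longrightarrow> v \<le> \<alpha> t \<Longrightarrow> near L t (k(z := v)) m \<Longrightarrow> near L' t k m"
    using absorb_bounded_var[OF L(1) assms(2), of z] by blast
  have "free_vars \<theta> - {x} = free_vars \<phi> - {x} - {z}"
    using \<theta> by auto
  then have "admissible (free_vars \<theta> - {x}) L'" using L'(1) by (simp only:)
  moreover have "controls x M \<theta> L'"
    unfolding controls_def
  proof (intro ballI allI impI)
    fix t k m p
    assume t: "t \<in> X" and p: "\<bar>p\<bar> \<le> M t"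
      and dvd: "\<forall>\<gamma>\<in>set2_form \<theta>. \<gamma> t \<noteq> 0 \<longrightarrow> \<gamma> t dvd p"
      and differ: "rsat t (k(x := m)) \<theta> \<noteq> rsat t (k(x := m + p)) \<theta>"
    have "\<exists>v. 0 \<le> v \<and> v \<le> \<alpha> t \<and>
        rsat t (k(x := m, z := v)) \<phi> \<noteq> rsat t (k(x := m + p, z := v)) \<phi>"
      using \<theta>
    proof
      assume eq: "\<theta> = Exists z (And (in_range \<alpha> z) \<phi>)"
      show ?thesis using differ unfolding eq rsat_simps rsat_in_range fun_upd_same by blast
    next
      assume eq: "\<theta> = Forall z (Imp (in_range \<alpha> z) \<phi>)"
      show ?thesis using differ unfolding eq rsat_simps rsat_in_range fun_upd_same by blast
    qed
    \<comment> \<open>Since \<open>z \<noteq> x\<close>, the updates commute, and \<open>v\<close>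
      becomes part of the assignment to which the control of \<open>\<phi>\<close> is
      applied.\<close>
    then obtain v where v: "0 \<le> v" "v \<le> \<alpha> t"
      "rsat t (k(z := v, x := m)) \<phi> \<noteq> rsat t (k(z := v, x := m + p)) \<phi>"
      unfolding fun_upd_twist[OF False[symmetric]] by blast
    have "\<forall>\<gamma>\<in>set2_form \<phi>. \<gamma> t \<noteq> 0 \<longrightarrow> \<gamma> t dvd p"
      using \<theta> dvd by auto
    then have "near L t (k(z := v)) m"
      using L(2) t p v(3) unfolding controls_def by blast
    then show "near L' t k m" using L'(2) t v by blast
  qed
  ultimately show ?thesis by blast
qed

text \<open>\<open>M\<close> is given beforehand because it enters the error bounds of the triples
  at the atoms.\<close>

lemma ex_controls:
  assumes "bounded_form R \<theta>" "M \<in> R"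
  shows "\<exists>L. admissible (free_vars \<theta> - {x}) L \<and> controls x M \<theta> L"
  using assms(1)
proof (induction rule: bounded_form.induct)
  case (Eq s u)
  show ?case by (rule controls_atom[OF _ _ assms(2)]) (use Eq in auto)
next
  case (Less s u)
  show ?case by (rule controls_atom[OF _ _ assms(2)]) (use Less in auto)
next
  case (Divis \<gamma> s)
  obtain \<sigma> s' where s': "rterm_vars s' \<subseteq> rterm_vars s - {x}"
    "\<And>t k. t \<in> X \<Longrightarrow> reval t k s = \<sigma> t * k x + reval t k s'"
    using term_split[OF Divis(2), of x] by blast
  then have "x \<notin> rterm_vars s'" by auto
  then have eval: "reval t (k(x := v)) s = \<sigma> t * v + reval t k s'" if "t \<in> X" for t k v
    using s'(2)[OF that] by simp
  \<comment> \<open>Divisibility atoms need no triple: a shift by a multiple of a nonzero modulus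
    preserves them, and with modulus 0 they are false throughout.\<close>
  have "\<gamma> t dvd reval t (k(x := m)) s \<longleftrightarrow> \<gamma> t dvd reval t (k(x := m + p)) s"
    if "t \<in> X" "\<gamma> t dvd p" for t k m p
  proof -
    have "reval t (k(x := m + p)) s = reval t (k(x := m)) s + \<sigma> t * p"
      using that(1) by (simp add: eval algebra_simps)
    then show ?thesis using that(2) by (simp add: dvd_add_left_iff)
  qed
  then have "controls x M (Divis \<gamma> s) {}"
    by (auto simp: controls_def)
  then show ?case by (intro exI[of _ "{}"]) simp
next
  case (Not \<phi>)
  then show ?case by (simp add: controls_def)
next
  case (And \<phi> \<psi>)
  show ?case by (rule controls_binary[of \<phi> x M \<psi>]) (use And in auto)
next
  case (Or \<phi> \<psi>)
  show ?case by (rule controls_binary[of \<phi> x M \<psi>]) (use Or in auto)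
next
  case (Imp \<phi> \<psi>)
  show ?case by (rule controls_binary[of \<phi> x M \<psi>]) (use Imp in auto)
next
  case (Exists \<alpha> \<phi> z)
  show ?case by (rule controls_quantifier[of \<phi> x M \<alpha> _ z]) (use Exists in auto)
next
  case (Forall \<alpha> \<phi> z)
  show ?case by (rule controls_quantifier[of \<phi> x M \<alpha> _ z]) (use Forall in auto)
qed

section \<open>Common multiples of the moduli and solutions close to a root\<close>

text \<open>
  The product of the nonzero values \<open>\<gamma>(t)\<close> need not be given by an element of \<open>R\<close>, but
  \<open>\<Prod>(1 + \<gamma>\<^sup>2)\<close> bounds it.
\<close>

lemma common_multiple_bound:
  assumes "finite G" "G \<subseteq> R"
  shows "\<exists>M\<in>R. \<forall>t\<in>X. \<exists>p. 0 < p \<and> p \<le> M t \<and> (\<forall>\<gamma>\<in>G. \<gamma> t \<noteq> 0 \<longrightarrow> \<gamma> t dvd p)"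
  using assms
proof (induction G rule: finite_induct)
  case empty
  show ?case by (intro bexI[of _ "\<lambda>t\<in>X. 1"] ballI exI[of _ 1]) auto
next
  case (insert \<gamma> G)
  then obtain M where M: "M \<in> R"
    "\<And>t. t \<in> X \<Longrightarrow> \<exists>p. 0 < p \<and> p \<le> M t \<and> (\<forall>\<gamma>\<in>G. \<gamma> t \<noteq> 0 \<longrightarrow> \<gamma> t dvd p)"
    by auto
  have "\<gamma> \<in> R" using insert.prems by simp
  obtain \<delta> where \<delta>: "\<delta> \<in> R" "\<And>t. t \<in> X \<Longrightarrow> \<delta> t = 1 + \<gamma> t * \<gamma> t"
    using ring_square_plus[OF \<open>\<gamma> \<in> R\<close> ring_closed(2) ring_closed(2)] by auto
  show ?case
  proof (intro bexI[of _ "\<lambda>t\<in>X. \<delta> t * M t"] ballI)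
    fix t assume t: "t \<in> X"
    obtain p where p: "0 < p" "p \<le> M t" "\<forall>\<gamma>\<in>G. \<gamma> t \<noteq> 0 \<longrightarrow> \<gamma> t dvd p"
      using M(2)[OF t] by blast
    \<comment> \<open>A vanishing modulus contributes the factor 1, which keeps the multiple
      positive.\<close>
    define q where "q = (if \<gamma> t = 0 then 1 else \<bar>\<gamma> t\<bar>)"
    have q: "0 < q" "q \<le> \<delta> t" "\<gamma> t \<noteq> 0 \<longrightarrow> \<gamma> t dvd q"
      using abs_le_square[of "\<gamma> t"] by (auto simp: q_def \<delta>(2)[OF t])
    have "0 < q * p" using p(1) q(1) by simp
    moreover have "q * p \<le> \<delta> t * M t"
      using p q by (intro mult_mono) auto
    moreover have "\<forall>\<gamma>'\<in>insert \<gamma> G. \<gamma>' t \<noteq> 0 \<longrightarrow> \<gamma>' t dvd q * p"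
      using p(3) q(3) by auto
    ultimately show "\<exists>p. 0 < p \<and> p \<le> (\<lambda>t\<in>X. \<delta> t * M t) t \<and>
        (\<forall>\<gamma>\<in>insert \<gamma> G. \<gamma> t \<noteq> 0 \<longrightarrow> \<gamma> t dvd p)"
      using t by auto
  qed (use \<delta> M in auto)
qed

text \<open>The set \<open>L\<close> is chosen before \<open>t\<close> and \<open>k\<close>, so the
  search for a solution becomes uniform in both.\<close>

lemma ex_near_solution:
  assumes "bounded_form R \<theta>"
  shows "\<exists>L. admissible (free_vars \<theta> - {x}) L \<and>
    (\<forall>t\<in>X. \<forall>k. (\<exists>m. rsat t (k(x := m)) \<theta>) \<longrightarrow> (\<exists>m. rsat t (k(x := m)) \<theta> \<and> near L t k m))"
proof -
  obtain M where M: "M \<in> R" "\<And>t. t \<in> X \<Longrightarrow>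
      \<exists>p. 0 < p \<and> p \<le> M t \<and> (\<forall>\<gamma>\<in>set2_form \<theta>. \<gamma> t \<noteq> 0 \<longrightarrow> \<gamma> t dvd p)"
    using common_multiple_bound[OF finite_moduli moduli_subset[OF assms]] by blast
  obtain L where L: "admissible (free_vars \<theta> - {x}) L" "controls x M \<theta> L"
    using ex_controls[OF assms M(1)] by blast
  \<comment> \<open>The additional triple says |x| \<le> M and covers the solutions of absolute
    value below p.\<close>
  let ?L = "insert (\<lambda>t\<in>X. 1, RZero, M) L"
  have "admissible (free_vars \<theta> - {x}) ?L"
    using L(1) M(1) by (auto simp: admissible_def)
  moreover have "\<exists>m. rsat t (k(x := m)) \<theta> \<and> near ?L t k m"
    if t: "t \<in> X" and sol: "\<exists>m. rsat t (k(x := m)) \<theta>" for t k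
  proof -
    obtain p where p: "0 < p" "p \<le> M t" "\<forall>\<gamma>\<in>set2_form \<theta>. \<gamma> t \<noteq> 0 \<longrightarrow> \<gamma> t dvd p"
      using M(2)[OF t] by blast
    obtain m where m: "rsat t (k(x := m)) \<theta>"
      and least: "\<And>m'. rsat t (k(x := m')) \<theta> \<Longrightarrow> nat \<bar>m\<bar> \<le> nat \<bar>m'\<bar>"
      using ex_has_least_nat[of "\<lambda>m. rsat t (k(x := m)) \<theta>" _ "\<lambda>m. nat \<bar>m\<bar>"] sol by blast
    have "near ?L t k m"
    proof (cases "\<bar>m\<bar> < p")
      case True
      then show ?thesis using t p by (auto simp: near_def)
    next
      case False
      \<comment> \<open>A shift by p towards zero: as |m| \<ge> p > 0, it lowers the absolute value,
        so by minimality the shifted point is not a solution.\<close>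
      define p' where "p' = (if m < 0 then p else - p)"
      have "\<bar>p'\<bar> \<le> M t" "\<forall>\<gamma>\<in>set2_form \<theta>. \<gamma> t \<noteq> 0 \<longrightarrow> \<gamma> t dvd p'" "\<bar>m + p'\<bar> < \<bar>m\<bar>"
        using p False by (auto simp: p'_def)
      moreover from this(3) have "\<not> rsat t (k(x := m + p')) \<theta>"
        using least[of "m + p'"] by auto
      ultimately have "near L t k m"
        using L(2) t m unfolding controls_def by blast
      then show ?thesis by (auto simp: near_def)
    qed
    with m show ?thesis by blast
  qed
  ultimately show ?thesis by blast
qed

section \<open>Substitution of fractions with a common denominator\<close>

text \<open>\<open>\<tau> i\<close> is the numerator of the fraction with denominator
  \<open>\<beta>\<close> that replaces variable \<open>i\<close>. Multiplication by
  \<open>\<beta>\<close> passes through all term constructors; a variable turns into its numerator,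
  and the constant 1 into \<open>\<beta>\<close>.\<close>

lemma term_subst_fraction:
  assumes "rterm_over R u" "\<beta> \<in> R" "\<forall>i. rterm_over R (\<tau> i)"
  shows "\<exists>u'. rterm_over R u' \<and> rterm_vars u' \<subseteq> (\<Union>i\<in>rterm_vars u. rterm_vars (\<tau> i)) \<and>
    (\<forall>t k k'. (\<forall>i\<in>rterm_vars u. \<beta> t * k' i = reval t k (\<tau> i)) \<longrightarrow>
       reval t k u' = \<beta> t * reval t k' u)"
  using assms(1)
proof (induction u)
  case (RVar i)
  show ?case using assms(3) by (intro exI[of _ "\<tau> i"]) auto
next
  case RZero
  show ?case by (intro exI[of _ RZero]) auto
next
  case ROne
  show ?case using assms(2) by (intro exI[of _ "RScale \<beta> ROne"]) auto
next
  case (RNeg u)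
  then obtain u' where "rterm_over R u'" "rterm_vars u' \<subseteq> (\<Union>i\<in>rterm_vars u. rterm_vars (\<tau> i))"
    "\<forall>t k k'. (\<forall>i\<in>rterm_vars u. \<beta> t * k' i = reval t k (\<tau> i)) \<longrightarrow> reval t k u' = \<beta> t * reval t k' u"
    by auto
  then show ?case by (intro exI[of _ "RNeg u'"]) auto
next
  case (RAdd u v)
  then obtain u' v'
    where "rterm_over R u'" "rterm_vars u' \<subseteq> (\<Union>i\<in>rterm_vars u. rterm_vars (\<tau> i))"
    "\<forall>t k k'. (\<forall>i\<in>rterm_vars u. \<beta> t * k' i = reval t k (\<tau> i)) \<longrightarrow> reval t k u' = \<beta> t * reval t k' u"
    "rterm_over R v'" "rterm_vars v' \<subseteq> (\<Union>i\<in>rterm_vars v. rterm_vars (\<tau> i))"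
    "\<forall>t k k'. (\<forall>i\<in>rterm_vars v. \<beta> t * k' i = reval t k (\<tau> i)) \<longrightarrow> reval t k v' = \<beta> t * reval t k' v"
    by auto
  then show ?case
    by (intro exI[of _ "RAdd u' v'"] conjI allI impI)
      (auto simp: distrib_left intro!: arg_cong2[where f = "(+)"])
next
  case (RScale \<alpha> u)
  then obtain u' where "rterm_over R u'" "rterm_vars u' \<subseteq> (\<Union>i\<in>rterm_vars u. rterm_vars (\<tau> i))"
    "\<forall>t k k'. (\<forall>i\<in>rterm_vars u. \<beta> t * k' i = reval t k (\<tau> i)) \<longrightarrow> reval t k u' = \<beta> t * reval t k' u"
    by auto
  with RScale show ?case by (intro exI[of _ "RScale \<alpha> u'"]) auto
qed

text \<open>Substitution of \<tau> i / \<beta> for \<open>i\<close>, described semantically: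
  \<open>k'\<close> holds the values of the fractions, so the equivalence is claimed only where
  these are integers.\<close>

definition represents_subst ::
  "('x \<Rightarrow> int) \<Rightarrow> (nat \<Rightarrow> 'x rterm) \<Rightarrow> 'x rform \<Rightarrow> 'x rform \<Rightarrow> bool" where
  "represents_subst \<beta> \<tau> \<theta> \<psi> \<longleftrightarrow> bounded_form R \<psi> \<and>
     free_vars \<psi> \<subseteq> (\<Union>i\<in>free_vars \<theta>. rterm_vars (\<tau> i)) \<and>
     (\<forall>t\<in>X. \<forall>k k'. \<beta> t \<noteq> 0 \<longrightarrow> (\<forall>i\<in>free_vars \<theta>. \<beta> t * k' i = reval t k (\<tau> i)) \<longrightarrow>
        (rsat t k \<psi> \<longleftrightarrow> rsat t k' \<theta>))"

text \<open>The bound variable is renamed to avoid capture. One \<open>\<psi>\<close> serves both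
  quantifiers.\<close>

lemma subst_quantifier:
  assumes IH: "\<And>\<tau>. \<forall>i. rterm_over R (\<tau> i) \<Longrightarrow> \<exists>\<psi>. represents_subst \<beta> \<tau> \<phi> \<psi>"
    and \<tau>: "\<forall>i. rterm_over R (\<tau> i)" and \<beta>: "\<beta> \<in> R" and \<alpha>: "\<alpha> \<in> R"
  shows "\<exists>z' \<psi>. represents_subst \<beta> \<tau> (Exists z (And (in_range \<alpha> z) \<phi>)) (Exists z' (And (in_range \<alpha> z') \<psi>)) \<and>
    represents_subst \<beta> \<tau> (Forall z (Imp (in_range \<alpha> z) \<phi>)) (Forall z' (Imp (in_range \<alpha> z') \<psi>))"
proof -
  obtain z' where z': "z' \<notin> (\<Union>i\<in>free_vars \<phi>. rterm_vars (\<tau> i))"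
    using fresh_var[of "\<Union>i\<in>free_vars \<phi>. rterm_vars (\<tau> i)"] by auto
  \<comment> \<open>With numerator \<beta>z' the fraction for \<open>z\<close> is z' itself, so the
    range from 0 to \<alpha> carries over unchanged.\<close>
  define \<tau>' where "\<tau>' = \<tau>(z := RScale \<beta> (RVar z'))"
  have "\<forall>i. rterm_over R (\<tau>' i)" using \<tau> \<beta> by (simp add: \<tau>'_def)
  then obtain \<psi> where \<psi>: "bounded_form R \<psi>" "free_vars \<psi> \<subseteq> (\<Union>i\<in>free_vars \<phi>. rterm_vars (\<tau>' i))"
    "\<And>t k k'. t \<in> X \<Longrightarrow> \<beta> t \<noteq> 0 \<Longrightarrow> (\<And>i. i \<in> free_vars \<phi> \<Longrightarrow> \<beta> t * k' i = reval t k (\<tau>' i)) \<Longrightarrow>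
        rsat t k \<psi> \<longleftrightarrow> rsat t k' \<phi>"
    using IH[of \<tau>'] unfolding represents_subst_def by blast
  have sub: "free_vars \<psi> - {z'} \<subseteq> (\<Union>i\<in>free_vars \<phi> - {z}. rterm_vars (\<tau> i))"
    using \<psi>(2) by (auto simp: \<tau>'_def split: if_splits)
  have sat: "rsat t (k(z' := v)) \<psi> \<longleftrightarrow> rsat t (k'(z := v)) \<phi>"
    if "t \<in> X" "\<beta> t \<noteq> 0" "\<forall>i\<in>free_vars \<phi> - {z}. \<beta> t * k' i = reval t k (\<tau> i)" for t k k' v
    using that z' by (intro \<psi>(3)) (auto simp: \<tau>'_def)
  show ?thesis
    using \<psi>(1) \<alpha> sub sat
    by (intro exI[of _ z'] exI[of _ \<psi>])
      (auto simp: represents_subst_def intro!: bounded_form.Exists bounded_form.Forall)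
qed

lemma subst_binary:
  assumes "represents_subst \<beta> \<tau> \<phi> \<phi>'" "represents_subst \<beta> \<tau> \<psi> \<psi>'"
  shows "represents_subst \<beta> \<tau> (And \<phi> \<psi>) (And \<phi>' \<psi>')"
    and "represents_subst \<beta> \<tau> (Or \<phi> \<psi>) (Or \<phi>' \<psi>')"
    and "represents_subst \<beta> \<tau> (Imp \<phi> \<psi>) (Imp \<phi>' \<psi>')"
proof -
  have bounded: "bounded_form R \<phi>'" "bounded_form R \<psi>'"
    and vars: "free_vars \<phi>' \<subseteq> (\<Union>i\<in>free_vars \<phi>. rterm_vars (\<tau> i))"
      "free_vars \<psi>' \<subseteq> (\<Union>i\<in>free_vars \<psi>. rterm_vars (\<tau> i))"
    using assms by (auto simp: represents_subst_def)
  have "rsat t k \<phi>' \<longleftrightarrow> rsat t k' \<phi>" "rsat t k \<psi>' \<longleftrightarrow> rsat t k' \<psi>"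
    if "t \<in> X" "\<beta> t \<noteq> 0" "\<forall>i\<in>free_vars \<phi> \<union> free_vars \<psi>. \<beta> t * k' i = reval t k (\<tau> i)" for t k k'
    using assms that unfolding represents_subst_def by blast+
  with bounded vars show "represents_subst \<beta> \<tau> (And \<phi> \<psi>) (And \<phi>' \<psi>')"
    "represents_subst \<beta> \<tau> (Or \<phi> \<psi>) (Or \<phi>' \<psi>')"
    "represents_subst \<beta> \<tau> (Imp \<phi> \<psi>) (Imp \<phi>' \<psi>')"
    by (auto simp: represents_subst_def intro!: bounded_form.And bounded_form.Or bounded_form.Imp)
qed

text \<open>Each atom is multiplied by a nonzero factor that clears the denominators.
  \<open>\<tau>\<close> is generalized in the induction because passing under a quantifier alters it
  at the bound variable.\<close>

lemma form_subst_fraction: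
  assumes "bounded_form R \<theta>" "\<beta> \<in> R" "\<forall>i. rterm_over R (\<tau> i)"
  shows "\<exists>\<psi>. represents_subst \<beta> \<tau> \<theta> \<psi>"
  using assms(1,3)
proof (induction arbitrary: \<tau> rule: bounded_form.induct)
  case (Eq s u)
  obtain s' where s': "rterm_over R s'" "rterm_vars s' \<subseteq> (\<Union>i\<in>rterm_vars s. rterm_vars (\<tau> i))"
    "\<forall>t k k'. (\<forall>i\<in>rterm_vars s. \<beta> t * k' i = reval t k (\<tau> i)) \<longrightarrow> reval t k s' = \<beta> t * reval t k' s"
    using term_subst_fraction[OF Eq(1) assms(2) Eq(3)] by blast
  obtain u' where u': "rterm_over R u'" "rterm_vars u' \<subseteq> (\<Union>i\<in>rterm_vars u. rterm_vars (\<tau> i))"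
    "\<forall>t k k'. (\<forall>i\<in>rterm_vars u. \<beta> t * k' i = reval t k (\<tau> i)) \<longrightarrow> reval t k u' = \<beta> t * reval t k' u"
    using term_subst_fraction[OF Eq(2) assms(2) Eq(3)] by blast
  show ?case
    unfolding represents_subst_def
  proof (intro exI[of _ "form.Eq s' u'"] conjI ballI allI impI)
    show "bounded_form R (form.Eq s' u')"
      using s'(1) u'(1) assms(2) Eq.hyps by (auto intro!: bounded_form.Eq ring_closed simp del: restrict_apply)
  next
    fix t k k'
    assume t: "t \<in> X" and nz: "\<beta> t \<noteq> 0"
      and eq: "\<forall>i\<in>free_vars (form.Eq s u). \<beta> t * k' i = reval t k (\<tau> i)"
    have "reval t k s' = \<beta> t * reval t k' s"
      using eq by (intro s'(3)[rule_format]) simp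
    moreover have "reval t k u' = \<beta> t * reval t k' u"
      using eq by (intro u'(3)[rule_format]) simp
    ultimately show "rsat t k (form.Eq s' u') \<longleftrightarrow> rsat t k' (form.Eq s u)"
      using t nz by simp
  qed (use s'(2) u'(2) in auto)
next
  case (Less s u)
  obtain s' where s': "rterm_over R s'" "rterm_vars s' \<subseteq> (\<Union>i\<in>rterm_vars s. rterm_vars (\<tau> i))"
    "\<forall>t k k'. (\<forall>i\<in>rterm_vars s. \<beta> t * k' i = reval t k (\<tau> i)) \<longrightarrow> reval t k s' = \<beta> t * reval t k' s"
    using term_subst_fraction[OF Less(1) assms(2) Less(3)] by blast
  obtain u' where u': "rterm_over R u'" "rterm_vars u' \<subseteq> (\<Union>i\<in>rterm_vars u. rterm_vars (\<tau> i))"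
    "\<forall>t k k'. (\<forall>i\<in>rterm_vars u. \<beta> t * k' i = reval t k (\<tau> i)) \<longrightarrow> reval t k u' = \<beta> t * reval t k' u"
    using term_subst_fraction[OF Less(2) assms(2) Less(3)] by blast
  have pos: "b * (b * c) < b * (b * d) \<longleftrightarrow> c < d" if "b \<noteq> 0" for b c d :: int
  proof -
    have "0 < b * b" using that by (auto simp: zero_less_mult_iff)
    then show ?thesis by (simp only: mult.assoc[symmetric] mult_less_cancel_left_pos)
  qed
  show ?case \<comment> \<open>scaling by \<open>\<beta>\<close> once more, since \<open>\<beta>(t)\<close> may be negative\<close>
    unfolding represents_subst_def
  proof (intro exI[of _ "form.Less (RScale \<beta> s') (RScale \<beta> u')"] conjI ballI allI impI)
    show "bounded_form R (form.Less (RScale \<beta> s') (RScale \<beta> u'))"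
      using s'(1) u'(1) assms(2) Less.hyps by (auto intro!: bounded_form.Less ring_closed simp del: restrict_apply)
  next
    fix t k k'
    assume t: "t \<in> X" and nz: "\<beta> t \<noteq> 0"
      and eq: "\<forall>i\<in>free_vars (form.Less s u). \<beta> t * k' i = reval t k (\<tau> i)"
    have "reval t k s' = \<beta> t * reval t k' s"
      using eq by (intro s'(3)[rule_format]) simp
    moreover have "reval t k u' = \<beta> t * reval t k' u"
      using eq by (intro u'(3)[rule_format]) simp
    ultimately show "rsat t k (form.Less (RScale \<beta> s') (RScale \<beta> u')) \<longleftrightarrow> rsat t k' (form.Less s u)"
      using t nz by (simp add: pos)
  qed (use s'(2) u'(2) in auto)
next
  case (Divis \<gamma> s)
  obtain s' where s': "rterm_over R s'" "rterm_vars s' \<subseteq> (\<Union>i\<in>rterm_vars s. rterm_vars (\<tau> i))"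
    "\<forall>t k k'. (\<forall>i\<in>rterm_vars s. \<beta> t * k' i = reval t k (\<tau> i)) \<longrightarrow> reval t k s' = \<beta> t * reval t k' s"
    using term_subst_fraction[OF Divis(2) assms(2) Divis(3)] by blast
  show ?case
    unfolding represents_subst_def
  \<comment> \<open>The modulus is multiplied along with the term: for \<beta> \<noteq> 0, \<gamma>
    divides s iff \<beta>\<gamma> divides \<beta>s.\<close>
  proof (intro exI[of _ "form.Divis (\<lambda>t\<in>X. \<beta> t * \<gamma> t) s'"] conjI ballI allI impI)
    show "bounded_form R (form.Divis (\<lambda>t\<in>X. \<beta> t * \<gamma> t) s')"
      using s'(1) assms(2) Divis.hyps by (auto intro!: bounded_form.Divis ring_closed simp del: restrict_apply)
  next
    fix t k k'
    assume t: "t \<in> X" and nz: "\<beta> t \<noteq> 0"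
      and eq: "\<forall>i\<in>free_vars (form.Divis \<gamma> s). \<beta> t * k' i = reval t k (\<tau> i)"
    have "reval t k s' = \<beta> t * reval t k' s"
      using eq by (intro s'(3)[rule_format]) simp
    then show "rsat t k (form.Divis (\<lambda>t\<in>X. \<beta> t * \<gamma> t) s') \<longleftrightarrow> rsat t k' (form.Divis \<gamma> s)"
      using t nz by simp
  qed (use s'(2) in auto)
next
  case (Not \<phi>)
  obtain \<phi>' where "represents_subst \<beta> \<tau> \<phi> \<phi>'" using Not.IH[OF Not.prems] by blast
  then show ?case
    by (intro exI[of _ "form.Not \<phi>'"]) (auto simp: represents_subst_def intro!: bounded_form.Not)
next
  case (And \<phi> \<psi>)
  obtain \<phi>' \<psi>' where "represents_subst \<beta> \<tau> \<phi> \<phi>'" "represents_subst \<beta> \<tau> \<psi> \<psi>'"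
    using And.IH(1)[OF And.prems] And.IH(2)[OF And.prems] by blast
  then show ?case by (blast intro: subst_binary(1))
next
  case (Or \<phi> \<psi>)
  obtain \<phi>' \<psi>' where "represents_subst \<beta> \<tau> \<phi> \<phi>'" "represents_subst \<beta> \<tau> \<psi> \<psi>'"
    using Or.IH(1)[OF Or.prems] Or.IH(2)[OF Or.prems] by blast
  then show ?case by (blast intro: subst_binary(2))
next
  case (Imp \<phi> \<psi>)
  obtain \<phi>' \<psi>' where "represents_subst \<beta> \<tau> \<phi> \<phi>'" "represents_subst \<beta> \<tau> \<psi> \<psi>'"
    using Imp.IH(1)[OF Imp.prems] Imp.IH(2)[OF Imp.prems] by blast
  then show ?case by (blast intro: subst_binary(3))
next
  case (Exists \<alpha> \<phi> z)
  show ?case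
    using subst_quantifier[OF Exists.IH Exists.prems assms(2) Exists.hyps(1)] by blast
next
  case (Forall \<alpha> \<phi> z)
  show ?case
    using subst_quantifier[OF Forall.IH Forall.prems assms(2) Forall.hyps(1)] by blast
qed

section \<open>Elimination of one existential quantifier\<close>

text \<open>Put z = \<beta>x + s + N. Then |\<beta>x + s| \<le> N means 0 \<le> z \<le> 2N, and x =
  (z - N - s)/\<beta>, so a bounded quantifier over z replaces the one over x.\<close>

lemma ex_near_single:
  assumes \<theta>: "bounded_form R \<theta>" and \<beta>: "\<beta> \<in> R" and N: "N \<in> R"
    and s: "rterm_over R s" "rterm_vars s \<subseteq> free_vars \<theta> - {x}"
  shows "\<exists>\<psi>. bounded_form R \<psi> \<and> free_vars \<psi> \<subseteq> free_vars \<theta> - {x} \<and>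
    (\<forall>t\<in>X. \<forall>k. rsat t k \<psi> \<longleftrightarrow>
       (\<exists>m. rsat t (k(x := m)) \<theta> \<and> \<beta> t \<noteq> 0 \<and> \<bar>\<beta> t * m + reval t k s\<bar> \<le> N t))"
proof -
  obtain z where z: "z \<notin> free_vars \<theta>" using fresh_var finite_free_vars by blast
  define u where "u = RAdd (RVar z) (RNeg (RAdd (RScale N ROne) s))"
  \<comment> \<open>\<open>u\<close> is the numerator z - N - s for \<open>x\<close>; every other
    variable keeps its value, written as the fraction \<beta>i/\<beta>.\<close>
  define \<tau> where "\<tau> = (\<lambda>i. RScale \<beta> (RVar i))(x := u)"
  have u_over: "rterm_over R u" using N s by (simp add: u_def)
  then have \<tau>: "\<forall>i. rterm_over R (\<tau> i)" using \<beta> by (simp add: \<tau>_def)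
  obtain \<chi> where "represents_subst \<beta> \<tau> \<theta> \<chi>"
    using form_subst_fraction[OF \<theta> \<beta> \<tau>] by blast
  then have \<chi>: "bounded_form R \<chi>" "free_vars \<chi> \<subseteq> (\<Union>i\<in>free_vars \<theta>. rterm_vars (\<tau> i))"
    "\<And>t k k'. t \<in> X \<Longrightarrow> \<beta> t \<noteq> 0 \<Longrightarrow> (\<And>i. i \<in> free_vars \<theta> \<Longrightarrow> \<beta> t * k' i = reval t k (\<tau> i)) \<Longrightarrow>
        rsat t k \<chi> \<longleftrightarrow> rsat t k' \<theta>"
    unfolding represents_subst_def by blast+
  define N2 where "N2 = (\<lambda>t\<in>X. N t + N t)"
  \<comment> \<open>\<open>Divis \<beta> u\<close> states that the fraction is an integer and also,
    as divisibility by 0 is false, that \<beta> does not vanish at t.\<close>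
  define \<psi> where "\<psi> = Exists z (And (in_range N2 z) (And (Divis \<beta> u) \<chi>))"
  have z_s: "z \<notin> rterm_vars s" using z s(2) by blast
  have "bounded_form R \<psi>"
    unfolding \<psi>_def N2_def using \<chi>(1) \<beta> N u_over
    by (intro bounded_form.Exists bounded_form.And bounded_form.Divis ring_closed)
  moreover have "free_vars \<psi> \<subseteq> free_vars \<theta> - {x}"
  proof -
    have "rterm_vars (\<tau> i) - {z} \<subseteq> free_vars \<theta> - {x}" if "i \<in> free_vars \<theta>" for i
      using s(2) that by (auto simp: \<tau>_def u_def)
    moreover have "rterm_vars u - {z} \<subseteq> free_vars \<theta> - {x}"
      using s(2) by (auto simp: u_def)
    moreover have "free_vars \<psi> = (rterm_vars u - {z}) \<union> (free_vars \<chi> - {z})"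
      by (auto simp: \<psi>_def)
    ultimately show ?thesis using \<chi>(2) by blast
  qed
  moreover have "rsat t k \<psi> \<longleftrightarrow>
       (\<exists>m. rsat t (k(x := m)) \<theta> \<and> \<beta> t \<noteq> 0 \<and> \<bar>\<beta> t * m + reval t k s\<bar> \<le> N t)"
    if t: "t \<in> X" for t k
  proof -
    have u_eval: "reval t (k(z := v)) u = v - N t - reval t k s" for v
      using z_s by (simp add: u_def)
    have sat: "rsat t (k(z := v)) \<chi> \<longleftrightarrow> rsat t (k(x := m)) \<theta>"
      if "\<beta> t \<noteq> 0" "\<beta> t * m = v - N t - reval t k s" for v m
      using that z by (intro \<chi>(3)[OF t]) (auto simp: \<tau>_def u_eval)
    show ?thesis
    proof
      assume "rsat t k \<psi>"
      then obtain v where v: "0 \<le> v" "v \<le> N t + N t" "\<beta> t \<noteq> 0"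
        "\<beta> t dvd v - N t - reval t k s" "rsat t (k(z := v)) \<chi>"
        using t by (auto simp: \<psi>_def u_eval N2_def)
      then obtain m where m: "v - N t - reval t k s = \<beta> t * m" by blast
      then have "\<bar>\<beta> t * m + reval t k s\<bar> \<le> N t" using v by (simp flip: m)
      then show "\<exists>m. rsat t (k(x := m)) \<theta> \<and> \<beta> t \<noteq> 0 \<and> \<bar>\<beta> t * m + reval t k s\<bar> \<le> N t"
        using v sat[OF v(3) m[symmetric]] by blast
    next
      assume "\<exists>m. rsat t (k(x := m)) \<theta> \<and> \<beta> t \<noteq> 0 \<and> \<bar>\<beta> t * m + reval t k s\<bar> \<le> N t"
      then obtain m where m: "rsat t (k(x := m)) \<theta>" "\<beta> t \<noteq> 0" "\<bar>\<beta> t * m + reval t k s\<bar> \<le> N t"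
        by blast
      define v where "v = \<beta> t * m + reval t k s + N t"
      have v: "\<beta> t * m = v - N t - reval t k s" by (simp add: v_def)
      have "0 \<le> v" "v \<le> N t + N t" using m(3) by (auto simp: v_def)
      moreover have "\<beta> t dvd v - N t - reval t k s" by (simp flip: v)
      ultimately show "rsat t k \<psi>"
        using t m(1,2) sat[OF m(2) v] by (auto simp: \<psi>_def u_eval N2_def)
    qed
  qed
  ultimately show ?thesis by blast
qed

text \<open>The existential quantifier distributes over the disjunction of the finitely many
  triples.\<close>

lemma ex_near_bounded:
  assumes \<theta>: "bounded_form R \<theta>" and "admissible (free_vars \<theta> - {x}) L"
  shows "\<exists>\<psi>. bounded_form R \<psi> \<and> free_vars \<psi> \<subseteq> free_vars \<theta> - {x} \<and>
    (\<forall>t\<in>X. \<forall>k. rsat t k \<psi> \<longleftrightarrow> (\<exists>m. rsat t (k(x := m)) \<theta> \<and> near L t k m))"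
proof -
  have "finite L" using assms(2) by (simp add: admissible_def)
  then show ?thesis using assms(2)
  proof (induction L rule: finite_induct)
    case empty
    \<comment> \<open>The atom 0 < 0 serves as falsity, the empty disjunction.\<close>
    have "bounded_form R (Less RZero RZero)" by (intro bounded_form.Less) auto
    then show ?case by (intro exI[of _ "Less RZero RZero"]) (auto simp: near_def)
  next
    case (insert q L)
    obtain \<beta> s N where q: "q = (\<beta>, s, N)" by (cases q)
    have adm: "admissible (free_vars \<theta> - {x}) L" and "\<beta> \<in> R" "N \<in> R"
      "rterm_over R s" "rterm_vars s \<subseteq> free_vars \<theta> - {x}"
      using insert.prems by (auto simp: admissible_def q)
    from ex_near_single[OF \<theta> this(2-5)] insert.IH[OF adm] obtain \<psi> \<psi>'
      where \<psi>: "bounded_form R \<psi>" "free_vars \<psi> \<subseteq> free_vars \<theta> - {x}"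
        "\<forall>t\<in>X. \<forall>k. rsat t k \<psi> \<longleftrightarrow>
          (\<exists>m. rsat t (k(x := m)) \<theta> \<and> \<beta> t \<noteq> 0 \<and> \<bar>\<beta> t * m + reval t k s\<bar> \<le> N t)"
        and \<psi>': "bounded_form R \<psi>'" "free_vars \<psi>' \<subseteq> free_vars \<theta> - {x}"
        "\<forall>t\<in>X. \<forall>k. rsat t k \<psi>' \<longleftrightarrow> (\<exists>m. rsat t (k(x := m)) \<theta> \<and> near L t k m)"
      by blast
    have near: "near (insert q L) t k m \<longleftrightarrow>
        (\<beta> t \<noteq> 0 \<and> \<bar>\<beta> t * m + reval t k s\<bar> \<le> N t) \<or> near L t k m" for t k m
      by (auto simp: near_def q)
    have "rsat t k (Or \<psi> \<psi>') \<longleftrightarrow>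
        (\<exists>m. rsat t (k(x := m)) \<theta> \<and> near (insert q L) t k m)" if "t \<in> X" for t k
      using \<psi>(3) \<psi>'(3) that unfolding rsat_simps near by blast
    moreover have "bounded_form R (Or \<psi> \<psi>')" "free_vars (Or \<psi> \<psi>') \<subseteq> free_vars \<theta> - {x}"
      using \<psi>(1,2) \<psi>'(1,2) by (auto intro: bounded_form.Or)
    ultimately show ?case by blast
  qed
qed

text \<open>Restricting the quantifier to points near \<open>L\<close> loses no satisfiable
  instance, and the restricted statement is expressible with bounded quantifiers.\<close>

lemma eliminate_exists:
  assumes "bounded_form R \<theta>"
  shows "\<exists>\<psi>. bounded_form R \<psi> \<and> free_vars \<psi> \<subseteq> free_vars \<theta> - {x} \<and>
    logically_equivalent X (Exists x \<theta>) \<psi>"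
proof -
  obtain L where L: "admissible (free_vars \<theta> - {x}) L"
    "\<forall>t\<in>X. \<forall>k. (\<exists>m. rsat t (k(x := m)) \<theta>) \<longrightarrow> (\<exists>m. rsat t (k(x := m)) \<theta> \<and> near L t k m)"
    using ex_near_solution[OF assms] by blast
  obtain \<psi> where \<psi>: "bounded_form R \<psi>" "free_vars \<psi> \<subseteq> free_vars \<theta> - {x}"
    "\<forall>t\<in>X. \<forall>k. rsat t k \<psi> \<longleftrightarrow> (\<exists>m. rsat t (k(x := m)) \<theta> \<and> near L t k m)"
    using ex_near_bounded[OF assms L(1)] by blast
  have "logically_equivalent X (Exists x \<theta>) \<psi>"
    using L(2) \<psi>(3) unfolding logically_equivalent_def rsat_simps by blast
  with \<psi>(1,2) show ?thesis by blast
qed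

section \<open>Elimination of all unbounded quantifiers\<close>

text \<open>Quantifiers are eliminated from the inside out. The inclusion of free variables is
  carried along so that the result is again a formula in the given variables.\<close>

lemma bounded_equivalent:
  assumes "rform_over R \<phi>"
  shows "\<exists>\<psi>. bounded_form R \<psi> \<and> free_vars \<psi> \<subseteq> free_vars \<phi> \<and> logically_equivalent X \<phi> \<psi>"
  using assms
proof (induction \<phi>)
  case (Eq s u)
  then show ?case
    by (intro exI[of _ "form.Eq s u"]) (auto simp: logically_equivalent_def intro: bounded_form.Eq)
next
  case (Less s u)
  then show ?case
    by (intro exI[of _ "form.Less s u"]) (auto simp: logically_equivalent_def intro: bounded_form.Less)
next
  case (Divis \<gamma> s)
  then show ?case
    by (intro exI[of _ "form.Divis \<gamma> s"]) (auto simp: logically_equivalent_def intro: bounded_form.Divis)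
next
  case (Not \<phi>)
  then obtain \<phi>' where "bounded_form R \<phi>'" "free_vars \<phi>' \<subseteq> free_vars \<phi>" "logically_equivalent X \<phi> \<phi>'"
    by auto
  then show ?case
    by (intro exI[of _ "form.Not \<phi>'"]) (auto simp: logically_equivalent_def intro: bounded_form.Not)
next
  case (And \<phi> \<psi>)
  then obtain \<phi>' \<psi>' where "bounded_form R \<phi>'" "free_vars \<phi>' \<subseteq> free_vars \<phi>" "logically_equivalent X \<phi> \<phi>'"
    "bounded_form R \<psi>'" "free_vars \<psi>' \<subseteq> free_vars \<psi>" "logically_equivalent X \<psi> \<psi>'"
    by auto
  then show ?case
    by (intro exI[of _ "form.And \<phi>' \<psi>'"]) (auto simp: logically_equivalent_def intro: bounded_form.And)
next
  case (Or \<phi> \<psi>)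
  then obtain \<phi>' \<psi>' where "bounded_form R \<phi>'" "free_vars \<phi>' \<subseteq> free_vars \<phi>" "logically_equivalent X \<phi> \<phi>'"
    "bounded_form R \<psi>'" "free_vars \<psi>' \<subseteq> free_vars \<psi>" "logically_equivalent X \<psi> \<psi>'"
    by auto
  then show ?case
    by (intro exI[of _ "form.Or \<phi>' \<psi>'"]) (auto simp: logically_equivalent_def intro: bounded_form.Or)
next
  case (Imp \<phi> \<psi>)
  then obtain \<phi>' \<psi>' where "bounded_form R \<phi>'" "free_vars \<phi>' \<subseteq> free_vars \<phi>" "logically_equivalent X \<phi> \<phi>'"
    "bounded_form R \<psi>'" "free_vars \<psi>' \<subseteq> free_vars \<psi>" "logically_equivalent X \<psi> \<psi>'"
    by auto
  then show ?case
    by (intro exI[of _ "form.Imp \<phi>' \<psi>'"]) (auto simp: logically_equivalent_def intro: bounded_form.Imp)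
next
  case (Exists x \<phi>)
  then obtain \<phi>' where \<phi>': "bounded_form R \<phi>'" "free_vars \<phi>' \<subseteq> free_vars \<phi>" "logically_equivalent X \<phi> \<phi>'"
    by auto
  obtain \<psi> where "bounded_form R \<psi>" "free_vars \<psi> \<subseteq> free_vars \<phi>' - {x}"
    "logically_equivalent X (form.Exists x \<phi>') \<psi>"
    using eliminate_exists[OF \<phi>'(1)] by blast
  with \<phi>' show ?case
    by (intro exI[of _ \<psi>]) (auto simp: logically_equivalent_def)
next
  case (Forall x \<phi>)
  then obtain \<phi>' where \<phi>': "bounded_form R \<phi>'" "free_vars \<phi>' \<subseteq> free_vars \<phi>" "logically_equivalent X \<phi> \<phi>'"
    by auto
  \<comment> \<open>The universal quantifier is treated as the negation of an existential
    one.\<close>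
  obtain \<psi> where "bounded_form R \<psi>" "free_vars \<psi> \<subseteq> free_vars (form.Not \<phi>') - {x}"
    "logically_equivalent X (form.Exists x (form.Not \<phi>')) \<psi>"
    using eliminate_exists[OF bounded_form.Not[OF \<phi>'(1)]] by blast
  moreover from this(3) \<phi>'(3) have "logically_equivalent X (form.Forall x \<phi>) (form.Not \<psi>)"
    unfolding logically_equivalent_def rsat_simps by blast
  ultimately show ?case
    using \<phi>'(2) by (intro exI[of _ "form.Not \<psi>"]) (auto intro: bounded_form.Not)
qed

end

theorem theorem1p4:
  fixes X :: "'x set" and R :: "('x \<Rightarrow> int) set" and \<phi> :: "'x rform" and d :: nat
  assumes "X \<noteq> {}"
    and "function_ring X R"
    and "\<And>c :: int. (\<lambda>t\<in>X. c) \<in> R"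
    and "rform_over R \<phi>"
    and "free_vars \<phi> \<subseteq> {1..d}"
  shows "\<exists>\<psi>. bounded_form R \<psi> \<and> free_vars \<psi> \<subseteq> {1..d} \<and> logically_equivalent X \<phi> \<psi>"
  using bounded_equivalent[OF assms(2,4)] assms(5) by (meson subset_trans)

end
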